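(* The function $\phi:A\times A^2\to\Bbbk^\times$, $(i;a,b)\mapsto\phi_i(a,b)=\nu(i,b,a)^{-1}\,t(a,b)\,\nu(i,a,b)$, is a shadow rack $2$-cocycle, i.e. $$\frac{\phi_{i}(a_2,a_3)}{\phi_{ia_1}(a_2,a_3)}\left[\frac{\phi_{i}(a_1,a_3)}{\phi_{ia_2}(a_1,a_3)}\right]^{-1}\frac{\phi_{i}(a_1,a_2)}{\phi_{ia_3}(a_1,a_2)}=1\qquad\text{for all } i,a_1,a_2,a_3\in A.$$
   Context: $\Bbbk$ is an algebraically closed field of characteristic $0$; $\mathcal{C}$ is a strict ribbon fusion category over $\Bbbk$ with braiding $\beta$, unit $\mathbf 1$ and universal grading group $A$ (finite abelian, identity $e$), $\mathcal{C}=\bigoplus_{a\in A}\mathcal{C}_a$. $\mathrm{Inv}(\mathcal{C}_e)$ denotes the invertible objects in $\mathcal{C}_e$. For $\eta$ invertible, $\chi_\eta:A\to\Bbbk^\times$ is the character with $\beta_{\eta,X}\circ\beta_{X,\eta}=\chi_\eta(a)\,\mathrm{id}$ for simple $X\in\mathcal{C}_a$. Ribbon zesting data $\zeta=(\lambda,\nu,t,\epsilon)$ for $\mathcal{C}$ is viewed numerically: $\lambda:A\times A\to\mathrm{Inv}(\mathcal{C}_e)$ satisfies $\lambda(e,a)=\lambda(a,e)=\mathbf 1$ and, on the level of objects, $\lambda(a,b)\otimes\lambda(ab,c)=\lambda(b,c)\otimes\lambda(a,bc)$, $\lambda(a,b)=\lambda(b,a)$ (and $\lambda(a,b)\otimes\lambda(c,d)=\lambda(c,d)\otimes\lambda(a,b)$,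 so that $\beta_{\lambda(a,b),\lambda(c,d)}$ is identified with a scalar depending only on the two objects). Put $\omega(a,b;c)=\chi_{\lambda(a,b)}(c)$. Then $\nu:A^3\to\Bbbk^\times$, $t:A^2\to\Bbbk^\times$, $\epsilon:A\to\{\pm1\}$ are functions, with $\nu$ and $t$ equal to $1$ whenever one argument is $e$ and $\epsilon(e)=1$, satisfying for all $a,b,c,d\in A$: - $\nu(b,c,d)\nu(a,bc,d)\nu(a,b,c)=\nu(a,b,cd)\,\beta^{-1}_{\lambda(a,b),\lambda(c,d)}\,\nu(ab,c,d)$; - $\nu(b,c,a)\,t(a,bc)\,\nu(a,b,c)=t(a,c)\,\nu(b,a,c)\,t(a,b)$; - $\omega(a,b;c)\,\nu(c,a,b)^{-1}t(ab,c)\nu(a,b,c)^{-1}=t(a,c)\nu(a,c,b)^{-1}t(b,c)$; - $\epsilon(ab)=\dim(\lambda(a,b))\,\epsilon(a)\epsilon(b)$. A function $\omega:A\times A^2\to\Bbbk^\times$, $(i;a,b)\mapsto\omega_i(a,b)$, is a shadow rack $2$-cocycle (for the shadow rack $(A,A)$ with trivial rack operation on $A$ and $A$ acting on itself by multiplication) if it satisfies the identity displayed in the claim. *)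

theory Defs
  imports
    "HOL-Algebra.Group"
    "HOL-Computational_Algebra.Polynomial"
    "HOL.Vector_Spaces"
begin

section \<open>Strict ribbon fusion categories\<close>

text \<open>
  Objects are the elements of the type \<^typ>\<open>'o\<close>. The spaces of morphisms are subspaces of
  one ambient \<open>\<k>\<close>-vector space \<^typ>\<open>'m\<close> (for instance the direct sum of all of them), so
  composition and tensor product are total functions on \<^typ>\<open>'m\<close>; the axioms restrict them on
  morphisms of the appropriate type only, and nothing is required elsewhere.
  As the category is strict, no associativity or unit constraints occur: sources and targets
  match because the objects are equal.
\<close>

record ('o, 'm, 'k) ribbon_data =
  Hom   :: "'o \<Rightarrow> 'o \<Rightarrow> 'm set"
  Comp  :: "'m \<Rightarrow> 'm \<Rightarrow> 'm"  (infixr \<open>\<cdot>\<index>\<close> 70)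
  Ident :: "'o \<Rightarrow> 'm"  (\<open>\<i>\<d>\<index>\<close>)
  Scal  :: "'k \<Rightarrow> 'm \<Rightarrow> 'm"  (infixr \<open>\<odot>\<^sub>k\<index>\<close> 75)
  TensO :: "'o \<Rightarrow> 'o \<Rightarrow> 'o"  (infixr \<open>\<otimes>\<^sub>o\<index>\<close> 80)
  TensM :: "'m \<Rightarrow> 'm \<Rightarrow> 'm"  (infixr \<open>\<otimes>\<^sub>m\<index>\<close> 80)
  Unit  :: 'o  (\<open>\<I>\<index>\<close>)
  Dual  :: "'o \<Rightarrow> 'o"
  Ev    :: "'o \<Rightarrow> 'm"
  Coev  :: "'o \<Rightarrow> 'm"
  Braid :: "'o \<Rightarrow> 'o \<Rightarrow> 'm"  (\<open>\<beta>\<index>\<close>)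
  Twist :: "'o \<Rightarrow> 'm"  (\<open>\<theta>\<index>\<close>)

definition is_iso :: "('o, 'm, 'k) ribbon_data \<Rightarrow> 'o \<Rightarrow> 'o \<Rightarrow> 'm \<Rightarrow> bool" where
  "is_iso C X Y f \<longleftrightarrow> f \<in> Hom C X Y \<and> (\<exists>g\<in>Hom C Y X. g \<cdot> f = \<i>\<d> X \<and> f \<cdot> g = \<i>\<d> Y)"
  for C (structure)

definition isomorphic :: "('o, 'm, 'k) ribbon_data \<Rightarrow> 'o \<Rightarrow> 'o \<Rightarrow> bool" where
  "isomorphic C X Y \<longleftrightarrow> (\<exists>f. is_iso C X Y f)"

definition is_mono :: "('o, 'm, 'k) ribbon_data \<Rightarrow> 'o \<Rightarrow> 'o \<Rightarrow> 'm \<Rightarrow> bool" where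
  "is_mono C X Y f \<longleftrightarrow> f \<in> Hom C X Y \<and>
     (\<forall>W. \<forall>g\<in>Hom C W X. \<forall>h\<in>Hom C W X. f \<cdot> g = f \<cdot> h \<longrightarrow> g = h)"
  for C (structure)

definition is_epi :: "('o, 'm, 'k) ribbon_data \<Rightarrow> 'o \<Rightarrow> 'o \<Rightarrow> 'm \<Rightarrow> bool" where
  "is_epi C X Y f \<longleftrightarrow> f \<in> Hom C X Y \<and>
     (\<forall>W. \<forall>g\<in>Hom C Y W. \<forall>h\<in>Hom C Y W. g \<cdot> f = h \<cdot> f \<longrightarrow> g = h)"
  for C (structure)

definition is_kernel ::
    "('o, 'm::zero, 'k) ribbon_data \<Rightarrow> 'o \<Rightarrow> 'o \<Rightarrow> 'm \<Rightarrow> 'o \<Rightarrow> 'm \<Rightarrow> bool" where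
  "is_kernel C X Y f K k \<longleftrightarrow> f \<in> Hom C X Y \<and> k \<in> Hom C K X \<and> f \<cdot> k = 0 \<and>
     (\<forall>W. \<forall>g\<in>Hom C W X. f \<cdot> g = 0 \<longrightarrow> (\<exists>!h. h \<in> Hom C W K \<and> k \<cdot> h = g))"
  for C (structure)

definition is_cokernel ::
    "('o, 'm::zero, 'k) ribbon_data \<Rightarrow> 'o \<Rightarrow> 'o \<Rightarrow> 'm \<Rightarrow> 'o \<Rightarrow> 'm \<Rightarrow> bool" where
  "is_cokernel C X Y f Q q \<longleftrightarrow> f \<in> Hom C X Y \<and> q \<in> Hom C Y Q \<and> q \<cdot> f = 0 \<and>
     (\<forall>W. \<forall>g\<in>Hom C Y W. g \<cdot> f = 0 \<longrightarrow> (\<exists>!h. h \<in> Hom C Q W \<and> h \<cdot> q = g))"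
  for C (structure)

definition is_zero_obj :: "('o, 'm::zero, 'k) ribbon_data \<Rightarrow> 'o \<Rightarrow> bool" where
  "is_zero_obj C X \<longleftrightarrow> \<i>\<d> X = 0"
  for C (structure)

definition simple_obj :: "('o, 'm::zero, 'k) ribbon_data \<Rightarrow> 'o \<Rightarrow> bool" where
  "simple_obj C X \<longleftrightarrow> \<not> is_zero_obj C X \<and>
     (\<forall>Y f. is_mono C Y X f \<longrightarrow> is_zero_obj C Y \<or> is_iso C Y X f)"

text \<open>\<open>X\<close> is a direct sum of \<open>Y 0, \<dots>, Y (n - 1)\<close>; for \<open>n = 0\<close> this says that \<open>X\<close> is zero.\<close>

definition is_direct_sum ::
    "('o, 'm::ab_group_add, 'k) ribbon_data \<Rightarrow> 'o \<Rightarrow> nat \<Rightarrow> (nat \<Rightarrow> 'o) \<Rightarrow> bool" where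
  "is_direct_sum C X n Y \<longleftrightarrow>
     (\<exists>i p. (\<forall>k<n. i k \<in> Hom C (Y k) X \<and> p k \<in> Hom C X (Y k)) \<and>
        (\<forall>k<n. \<forall>l<n. p l \<cdot> i k = (if k = l then \<i>\<d> (Y k) else 0)) \<and>
        (\<Sum>k<n. i k \<cdot> p k) = \<i>\<d> X)"
  for C (structure)

definition invertible_obj :: "('o, 'm, 'k) ribbon_data \<Rightarrow> 'o \<Rightarrow> bool" where
  "invertible_obj C X \<longleftrightarrow>
     (\<exists>Y. isomorphic C (X \<otimes>\<^sub>o Y) \<I> \<and> isomorphic C (Y \<otimes>\<^sub>o X) \<I>)"
  for C (structure)

text \<open>The transpose \<open>Y\<^sup>* \<rightarrow> X\<^sup>*\<close> of a morphism \<open>f : X \<rightarrow> Y\<close>.\<close>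

definition transpose_mor :: "('o, 'm, 'k) ribbon_data \<Rightarrow> 'o \<Rightarrow> 'o \<Rightarrow> 'm \<Rightarrow> 'm" where
  "transpose_mor C X Y f =
     (Ev C Y \<otimes>\<^sub>m \<i>\<d> (Dual C X)) \<cdot> (\<i>\<d> (Dual C Y) \<otimes>\<^sub>m f \<otimes>\<^sub>m \<i>\<d> (Dual C X))
       \<cdot> (\<i>\<d> (Dual C Y) \<otimes>\<^sub>m Coev C X)"
  for C (structure)

locale linear_category =
  fixes C :: "('o, 'm::ab_group_add, 'k::field) ribbon_data" (structure)
  assumes vector_space: "vector_space (Scal C)"
    and Hom_subspace: "module.subspace (Scal C) (Hom C X Y)"
    and id_in_Hom: "\<i>\<d> X \<in> Hom C X X"
    and comp_in_Hom: "f \<in> Hom C X Y \<Longrightarrow> g \<in> Hom C Y Z \<Longrightarrow> g \<cdot> f \<in> Hom C X Z"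
    and id_comp: "f \<in> Hom C X Y \<Longrightarrow> \<i>\<d> Y \<cdot> f = f"
    and comp_id: "f \<in> Hom C X Y \<Longrightarrow> f \<cdot> \<i>\<d> X = f"
    and comp_assoc: "f \<in> Hom C W X \<Longrightarrow> g \<in> Hom C X Y \<Longrightarrow> h \<in> Hom C Y Z \<Longrightarrow>
      (h \<cdot> g) \<cdot> f = h \<cdot> (g \<cdot> f)"
    and comp_add_left: "f \<in> Hom C X Y \<Longrightarrow> g \<in> Hom C Y Z \<Longrightarrow> g' \<in> Hom C Y Z \<Longrightarrow>
      (g + g') \<cdot> f = g \<cdot> f + g' \<cdot> f"
    and comp_add_right: "f \<in> Hom C X Y \<Longrightarrow> f' \<in> Hom C X Y \<Longrightarrow> g \<in> Hom C Y Z \<Longrightarrow>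
      g \<cdot> (f + f') = g \<cdot> f + g \<cdot> f'"
    and comp_scale_left: "f \<in> Hom C X Y \<Longrightarrow> g \<in> Hom C Y Z \<Longrightarrow>
      (z \<odot>\<^sub>k g) \<cdot> f = z \<odot>\<^sub>k (g \<cdot> f)"
    and comp_scale_right: "f \<in> Hom C X Y \<Longrightarrow> g \<in> Hom C Y Z \<Longrightarrow>
      g \<cdot> (z \<odot>\<^sub>k f) = z \<odot>\<^sub>k (g \<cdot> f)"

locale abelian_category = linear_category +
  assumes direct_sums: "\<forall>n Y. \<exists>X. is_direct_sum C X n Y"
    and kernels: "f \<in> Hom C X Y \<Longrightarrow> \<exists>K k. is_kernel C X Y f K k"
    and cokernels: "f \<in> Hom C X Y \<Longrightarrow> \<exists>Q q. is_cokernel C X Y f Q q"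
    and mono_normal: "is_mono C X Y f \<Longrightarrow> \<exists>Z g. is_kernel C Y Z g X f"
    and epi_normal: "is_epi C X Y f \<Longrightarrow> \<exists>W g. is_cokernel C W X g Y f"

locale strict_monoidal_category = linear_category +
  assumes tensO_assoc: "(X \<otimes>\<^sub>o Y) \<otimes>\<^sub>o Z = X \<otimes>\<^sub>o (Y \<otimes>\<^sub>o Z)"
    and unit_tensO: "\<I> \<otimes>\<^sub>o X = X"
    and tensO_unit: "X \<otimes>\<^sub>o \<I> = X"
    and tensM_in_Hom: "f \<in> Hom C X Y \<Longrightarrow> g \<in> Hom C X' Y' \<Longrightarrow>
      f \<otimes>\<^sub>m g \<in> Hom C (X \<otimes>\<^sub>o X') (Y \<otimes>\<^sub>o Y')"
    and tensM_id: "\<i>\<d> X \<otimes>\<^sub>m \<i>\<d> Y = \<i>\<d> (X \<otimes>\<^sub>o Y)"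
    and tensM_comp: "f \<in> Hom C X Y \<Longrightarrow> g \<in> Hom C Y Z \<Longrightarrow>
      f' \<in> Hom C X' Y' \<Longrightarrow> g' \<in> Hom C Y' Z' \<Longrightarrow>
      (g \<cdot> f) \<otimes>\<^sub>m (g' \<cdot> f') = (g \<otimes>\<^sub>m g') \<cdot> (f \<otimes>\<^sub>m f')"
    and tensM_assoc: "f \<in> Hom C X X' \<Longrightarrow> g \<in> Hom C Y Y' \<Longrightarrow> h \<in> Hom C Z Z' \<Longrightarrow>
      (f \<otimes>\<^sub>m g) \<otimes>\<^sub>m h = f \<otimes>\<^sub>m (g \<otimes>\<^sub>m h)"
    and unit_tensM: "f \<in> Hom C X Y \<Longrightarrow> \<i>\<d> \<I> \<otimes>\<^sub>m f = f"
    and tensM_unit: "f \<in> Hom C X Y \<Longrightarrow> f \<otimes>\<^sub>m \<i>\<d> \<I> = f"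
    and tensM_add_left: "f \<in> Hom C X Y \<Longrightarrow> f' \<in> Hom C X Y \<Longrightarrow> g \<in> Hom C X' Y' \<Longrightarrow>
      (f + f') \<otimes>\<^sub>m g = f \<otimes>\<^sub>m g + f' \<otimes>\<^sub>m g"
    and tensM_add_right: "f \<in> Hom C X Y \<Longrightarrow> g \<in> Hom C X' Y' \<Longrightarrow> g' \<in> Hom C X' Y' \<Longrightarrow>
      f \<otimes>\<^sub>m (g + g') = f \<otimes>\<^sub>m g + f \<otimes>\<^sub>m g'"
    and tensM_scale_left: "f \<in> Hom C X Y \<Longrightarrow> g \<in> Hom C X' Y' \<Longrightarrow>
      (z \<odot>\<^sub>k f) \<otimes>\<^sub>m g = z \<odot>\<^sub>k (f \<otimes>\<^sub>m g)"
    and tensM_scale_right: "f \<in> Hom C X Y \<Longrightarrow> g \<in> Hom C X' Y' \<Longrightarrow>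
      f \<otimes>\<^sub>m (z \<odot>\<^sub>k g) = z \<odot>\<^sub>k (f \<otimes>\<^sub>m g)"

text \<open>Right duals need no separate axiom: the braiding turns left duals into right duals.\<close>

locale strict_ribbon_category = strict_monoidal_category +
  assumes ev_in_Hom: "Ev C X \<in> Hom C (Dual C X \<otimes>\<^sub>o X) \<I>"
    and coev_in_Hom: "Coev C X \<in> Hom C \<I> (X \<otimes>\<^sub>o Dual C X)"
    and zigzag: "(\<i>\<d> X \<otimes>\<^sub>m Ev C X) \<cdot> (Coev C X \<otimes>\<^sub>m \<i>\<d> X) = \<i>\<d> X"
    and zigzag_dual:
      "(Ev C X \<otimes>\<^sub>m \<i>\<d> (Dual C X)) \<cdot> (\<i>\<d> (Dual C X) \<otimes>\<^sub>m Coev C X) = \<i>\<d> (Dual C X)"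
    and braid_iso: "is_iso C (X \<otimes>\<^sub>o Y) (Y \<otimes>\<^sub>o X) (\<beta> X Y)"
    and braid_natural: "f \<in> Hom C X X' \<Longrightarrow> g \<in> Hom C Y Y' \<Longrightarrow>
      \<beta> X' Y' \<cdot> (f \<otimes>\<^sub>m g) = (g \<otimes>\<^sub>m f) \<cdot> \<beta> X Y"
    and hexagon_left: "\<beta> (X \<otimes>\<^sub>o Y) Z = (\<beta> X Z \<otimes>\<^sub>m \<i>\<d> Y) \<cdot> (\<i>\<d> X \<otimes>\<^sub>m \<beta> Y Z)"
    and hexagon_right: "\<beta> X (Y \<otimes>\<^sub>o Z) = (\<i>\<d> Y \<otimes>\<^sub>m \<beta> X Z) \<cdot> (\<beta> X Y \<otimes>\<^sub>m \<i>\<d> Z)"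
    and twist_iso: "is_iso C X X (\<theta> X)"
    and twist_natural: "f \<in> Hom C X Y \<Longrightarrow> \<theta> Y \<cdot> f = f \<cdot> \<theta> X"
    and twist_tens: "\<theta> (X \<otimes>\<^sub>o Y) = \<beta> Y X \<cdot> \<beta> X Y \<cdot> (\<theta> X \<otimes>\<^sub>m \<theta> Y)"
    and twist_dual: "\<theta> (Dual C X) = transpose_mor C X X (\<theta> X)"

locale strict_ribbon_fusion_category = strict_ribbon_category + abelian_category +
  assumes finite_dim_Hom: "\<exists>B. finite B \<and> Hom C X Y = module.span (Scal C) B"
    and semisimple: "\<exists>n Y. (\<forall>k<n. simple_obj C (Y k)) \<and> is_direct_sum C X n Y"
    and finitely_many_simples:
      "\<exists>S. finite S \<and> (\<forall>X. simple_obj C X \<longrightarrow> (\<exists>Y\<in>S. isomorphic C X Y))"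
    and unit_simple: "simple_obj C \<I>"

text \<open>
  The categorical dimension \<open>\<I> \<rightarrow> X \<otimes> X\<^sup>* \<rightarrow> X\<^sup>* \<otimes> X \<rightarrow> \<I>\<close>, as a scalar. It is
  well defined because \<open>\<I>\<close> is simple.
\<close>

definition qdim :: "('o, 'm, 'k) ribbon_data \<Rightarrow> 'o \<Rightarrow> 'k" where
  "qdim C X = (THE z. Ev C X \<cdot> \<beta> X (Dual C X) \<cdot> (\<theta> X \<otimes>\<^sub>m \<i>\<d> (Dual C X)) \<cdot> Coev C X
     = z \<odot>\<^sub>k \<i>\<d> \<I>)"
  for C (structure)

text \<open>
  For invertible \<open>X\<close>, \<open>Y\<close> with \<open>X \<otimes> Y = Y \<otimes> X\<close> as objects, the braiding \<open>\<beta>\<^sub>X\<^sub>,\<^sub>Y\<close> is an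
  automorphism of the simple object \<open>X \<otimes> Y\<close>, hence a scalar.
\<close>

definition braid_scalar :: "('o, 'm, 'k) ribbon_data \<Rightarrow> 'o \<Rightarrow> 'o \<Rightarrow> 'k" where
  "braid_scalar C X Y = (THE z. \<beta> X Y = z \<odot>\<^sub>k \<i>\<d> (X \<otimes>\<^sub>o Y))"
  for C (structure)

section \<open>The universal grading\<close>

text \<open>
  \<open>D a\<close> is the class of objects of the component \<open>\<C>\<^sub>a\<close>; the components are full
  subcategories.
\<close>

definition grading ::
    "('o, 'm::ab_group_add, 'k) ribbon_data \<Rightarrow> 'a monoid \<Rightarrow> ('a \<Rightarrow> 'o set) \<Rightarrow> bool" where
  "grading C A D \<longleftrightarrow> group A \<and>
     (\<forall>a\<in>carrier A. \<forall>X n Y. (\<forall>k<n. Y k \<in> D a) \<and> is_direct_sum C X n Y \<longrightarrow> X \<in> D a) \<and>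
     (\<forall>X. \<exists>n Y. (\<forall>k<n. \<exists>a\<in>carrier A. Y k \<in> D a) \<and> is_direct_sum C X n Y) \<and>
     (\<forall>a\<in>carrier A. \<forall>b\<in>carrier A. a \<noteq> b \<longrightarrow>
        (\<forall>X\<in>D a. \<forall>Y\<in>D b. Hom C X Y = {0})) \<and>
     (\<forall>a\<in>carrier A. \<forall>b\<in>carrier A. \<forall>X\<in>D a. \<forall>Y\<in>D b. X \<otimes>\<^sub>o Y \<in> D (a \<otimes>\<^bsub>A\<^esub> b))"
  for C (structure)

definition faithful_grading ::
    "('o, 'm::ab_group_add, 'k) ribbon_data \<Rightarrow> 'a monoid \<Rightarrow> ('a \<Rightarrow> 'o set) \<Rightarrow> bool" where
  "faithful_grading C A D \<longleftrightarrow> grading C A D \<and>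
     (\<forall>a\<in>carrier A. \<exists>X\<in>D a. \<not> is_zero_obj C X)"

text \<open>
  The universal grading is the faithful grading from which every faithful grading is obtained
  along a group homomorphism. A group that faithfully grades a fusion category is finite, so
  it is no restriction to take the competing groups on subsets of \<^typ>\<open>nat\<close>.
\<close>

definition universal_grading ::
    "('o, 'm::ab_group_add, 'k) ribbon_data \<Rightarrow> 'a monoid \<Rightarrow> ('a \<Rightarrow> 'o set) \<Rightarrow> bool" where
  "universal_grading C A D \<longleftrightarrow> faithful_grading C A D \<and>
     (\<forall>(G :: nat monoid) E. faithful_grading C G E \<longrightarrow>
        (\<exists>h\<in>hom A G. \<forall>a\<in>carrier A. D a \<subseteq> E (h a)))"

definition grading_character ::
    "('o, 'm::zero, 'k) ribbon_data \<Rightarrow> ('a \<Rightarrow> 'o set) \<Rightarrow> 'o \<Rightarrow> 'a \<Rightarrow> 'k" where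
  "grading_character C D \<eta> a = (THE z. \<forall>X\<in>D a. simple_obj C X \<longrightarrow>
     \<beta> \<eta> X \<cdot> \<beta> X \<eta> = z \<odot>\<^sub>k \<i>\<d> (X \<otimes>\<^sub>o \<eta>))"
  for C (structure)

section \<open>Ribbon zesting data\<close>

locale ribbon_zesting =
  fixes C :: "('o, 'm::ab_group_add, 'k::field) ribbon_data"
    and A :: "'a monoid" (structure)
    and D :: "'a \<Rightarrow> 'o set"
    and lam :: "'a \<Rightarrow> 'a \<Rightarrow> 'o"
    and \<nu> :: "'a \<Rightarrow> 'a \<Rightarrow> 'a \<Rightarrow> 'k"
    and t :: "'a \<Rightarrow> 'a \<Rightarrow> 'k"
    and \<epsilon> :: "'a \<Rightarrow> 'k"
  assumes lam_invertible: "a \<in> carrier A \<Longrightarrow> b \<in> carrier A \<Longrightarrow> invertible_obj C (lam a b)"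
    and lam_trivial_component: "a \<in> carrier A \<Longrightarrow> b \<in> carrier A \<Longrightarrow> lam a b \<in> D \<one>"
    and lam_normalized: "a \<in> carrier A \<Longrightarrow> lam \<one> a = \<I>\<^bsub>C\<^esub> \<and> lam a \<one> = \<I>\<^bsub>C\<^esub>"
    and lam_cocycle: "a \<in> carrier A \<Longrightarrow> b \<in> carrier A \<Longrightarrow> c \<in> carrier A \<Longrightarrow>
      lam a b \<otimes>\<^sub>o\<^bsub>C\<^esub> lam (a \<otimes> b) c = lam b c \<otimes>\<^sub>o\<^bsub>C\<^esub> lam a (b \<otimes> c)"
    and lam_symmetric: "a \<in> carrier A \<Longrightarrow> b \<in> carrier A \<Longrightarrow> lam a b = lam b a"
    and lam_commute: "a \<in> carrier A \<Longrightarrow> b \<in> carrier A \<Longrightarrow> c \<in> carrier A \<Longrightarrow> d \<in> carrier A \<Longrightarrow>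
      lam a b \<otimes>\<^sub>o\<^bsub>C\<^esub> lam c d = lam c d \<otimes>\<^sub>o\<^bsub>C\<^esub> lam a b"
    and \<nu>_nonzero: "a \<in> carrier A \<Longrightarrow> b \<in> carrier A \<Longrightarrow> c \<in> carrier A \<Longrightarrow> \<nu> a b c \<noteq> 0"
    and t_nonzero: "a \<in> carrier A \<Longrightarrow> b \<in> carrier A \<Longrightarrow> t a b \<noteq> 0"
    and \<epsilon>_sign: "a \<in> carrier A \<Longrightarrow> \<epsilon> a = 1 \<or> \<epsilon> a = - 1"
    and \<nu>_normalized: "a \<in> carrier A \<Longrightarrow> b \<in> carrier A \<Longrightarrow>
      \<nu> \<one> a b = 1 \<and> \<nu> a \<one> b = 1 \<and> \<nu> a b \<one> = 1"
    and t_normalized: "a \<in> carrier A \<Longrightarrow> t \<one> a = 1 \<and> t a \<one> = 1"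
    and \<epsilon>_normalized: "\<epsilon> \<one> = 1"
    and associative_zesting:
      "a \<in> carrier A \<Longrightarrow> b \<in> carrier A \<Longrightarrow> c \<in> carrier A \<Longrightarrow> d \<in> carrier A \<Longrightarrow>
      \<nu> b c d * \<nu> a (b \<otimes> c) d * \<nu> a b c =
      \<nu> a b (c \<otimes> d) * inverse (braid_scalar C (lam a b) (lam c d)) * \<nu> (a \<otimes> b) c d"
    and braided_zesting_1: "a \<in> carrier A \<Longrightarrow> b \<in> carrier A \<Longrightarrow> c \<in> carrier A \<Longrightarrow>
      \<nu> b c a * t a (b \<otimes> c) * \<nu> a b c = t a c * \<nu> b a c * t a b"
    and braided_zesting_2: "a \<in> carrier A \<Longrightarrow> b \<in> carrier A \<Longrightarrow> c \<in> carrier A \<Longrightarrow>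
      grading_character C D (lam a b) c * inverse (\<nu> c a b) * t (a \<otimes> b) c * inverse (\<nu> a b c)
      = t a c * inverse (\<nu> a c b) * t b c"
    and twist_zesting: "a \<in> carrier A \<Longrightarrow> b \<in> carrier A \<Longrightarrow>
      \<epsilon> (a \<otimes> b) = qdim C (lam a b) * \<epsilon> a * \<epsilon> b"

section \<open>Shadow rack cocycles\<close>

text \<open>
  The rack is \<open>A\<close> with the trivial operation, and the shadow is \<open>A\<close> acting on itself by
  multiplication; \<open>\<phi> i a b\<close> stands for \<open>\<phi>\<^sub>i(a, b)\<close>.
\<close>

definition shadow_rack_2_cocycle ::
    "'a monoid \<Rightarrow> ('a \<Rightarrow> 'a \<Rightarrow> 'a \<Rightarrow> 'k::field) \<Rightarrow> bool" where
  "shadow_rack_2_cocycle A \<phi> \<longleftrightarrow>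
     (\<forall>i\<in>carrier A. \<forall>a\<in>carrier A. \<forall>b\<in>carrier A. \<phi> i a b \<noteq> 0) \<and>
     (\<forall>i\<in>carrier A. \<forall>a1\<in>carrier A. \<forall>a2\<in>carrier A. \<forall>a3\<in>carrier A.
        \<phi> i a2 a3 / \<phi> (i \<otimes> a1) a2 a3
          * inverse (\<phi> i a1 a3 / \<phi> (i \<otimes> a2) a1 a3)
          * (\<phi> i a1 a2 / \<phi> (i \<otimes> a3) a1 a2) = 1)"
  for A (structure)

end

theory Submission
  imports Defs
begin

text \<open>
  In \<open>\<phi>\<^sub>i(a,b) / \<phi>\<^sub>i\<^sub>x(a,b)\<close> the factor \<open>t(a,b)\<close> cancels, so the claim concerns only the skew part
  \<open>r\<^sub>i(a,b) = \<nu>(i,a,b) / \<nu>(i,b,a)\<close> of \<open>\<nu>\<close>. Compare the associative zesting equation for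
  \<open>(i,a,b,c)\<close> with the one for \<open>(i,a,c,b)\<close>: the braiding scalar and \<open>\<nu>(i,a,bc)\<close> are the same in
  both, because \<open>\<lambda>\<close> is symmetric and the group is commutative. Dividing the two equations
  therefore expresses \<open>r\<^sub>i\<^sub>a(b,c)\<close> through \<open>\<nu>\<close> alone (\<open>skew_translate\<close>), as
  if \<open>\<nu>\<close> were an honest 3-cocycle.

  In the shadow cocycle expression these substitutions make all factors whose first argument is
  \<open>i\<close> cancel. What is left is the alternating product of \<open>\<nu>\<close> over the six orderings of
  \<open>a\<^sub>1, a\<^sub>2, a\<^sub>3\<close>. That product is trivial because \<open>t\<close> exhibits
  \<open>\<nu>(b,c,a) \<nu>(a,b,c) / \<nu>(b,a,c)\<close> as a quantity symmetric in \<open>b\<close> and \<open>c\<close>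
  (\<open>alternating_product_trivial\<close>).
\<close>

context ribbon_zesting
begin

text \<open>
  By the first braided zesting equation,
  \<open>\<nu>(b,c,a) \<nu>(a,b,c) / \<nu>(b,a,c) = t(a,b) t(a,c) / t(a,bc)\<close>, and the right-hand side does not
  change when \<open>b\<close> and \<open>c\<close> are exchanged.
\<close>

lemma alternating_product_trivial:
  assumes "comm_group A" and a: "a \<in> carrier A" and b: "b \<in> carrier A" and c: "c \<in> carrier A"
  shows "\<nu> a b c * \<nu> b c a * \<nu> c a b = \<nu> a c b * \<nu> b a c * \<nu> c b a"
proof -
  interpret comm_group A by fact
  have bc: "c \<otimes> b = b \<otimes> c"
    using b c by (rule m_comm[symmetric])
  have "b \<otimes> c \<in> carrier A"
    using b c by simp
  with a b c have t: "t a (b \<otimes> c) \<noteq> 0" "t a b \<noteq> 0" "t a c \<noteq> 0"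
    by (simp_all add: t_nonzero)
  let ?p = "t a (b \<otimes> c)" and ?q = "t a b * t a c"
  have 1: "?p * (\<nu> b c a * \<nu> a b c) = ?q * \<nu> b a c"
    using braided_zesting_1[OF a b c] by (simp add: ac_simps)
  have 2: "?p * (\<nu> c b a * \<nu> a c b) = ?q * \<nu> c a b"
    using braided_zesting_1[OF a c b] by (simp add: ac_simps bc)
  have "(?p * ?q) * (\<nu> a b c * \<nu> b c a * \<nu> c a b)
      = (?p * (\<nu> b c a * \<nu> a b c)) * (?q * \<nu> c a b)"
    by (simp only: ac_simps)
  also have "\<dots> = (?q * \<nu> b a c) * (?p * (\<nu> c b a * \<nu> a c b))"
    by (simp only: 1 2)
  also have "\<dots> = (?p * ?q) * (\<nu> a c b * \<nu> b a c * \<nu> c b a)"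
    by (simp only: ac_simps)
  finally show ?thesis
    using t by simp
qed

text \<open>
  Here \<open>\<nu>\<close> fails to be a 3-cocycle only by the scalar of \<open>\<beta>\<close> on \<open>\<lambda>(i,a)\<close> and \<open>\<lambda>(b,c)\<close>, which is
  symmetric in \<open>b\<close> and \<open>c\<close> and so drops out of the quotient.
\<close>

lemma skew_translate:
  assumes "comm_group A" and i: "i \<in> carrier A"
    and a: "a \<in> carrier A" and b: "b \<in> carrier A" and c: "c \<in> carrier A"
  shows "\<nu> (i \<otimes> a) b c / \<nu> (i \<otimes> a) c b =
    (\<nu> a b c / \<nu> a c b) * (\<nu> i (a \<otimes> b) c / \<nu> i (a \<otimes> c) b) * (\<nu> i a b / \<nu> i a c)"
proof -
  interpret comm_group A by fact
  let ?s = "\<nu> i a (b \<otimes> c) * inverse (braid_scalar C (lam i a) (lam b c))"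
  have 1: "\<nu> a b c * \<nu> i (a \<otimes> b) c * \<nu> i a b = ?s * \<nu> (i \<otimes> a) b c"
    by (rule associative_zesting[OF i a b c])
  have 2: "\<nu> a c b * \<nu> i (a \<otimes> c) b * \<nu> i a c = ?s * \<nu> (i \<otimes> a) c b"
    using associative_zesting[OF i a c b] lam_symmetric[OF b c] m_comm[OF b c] by simp
  have nz: "\<nu> a b c * \<nu> i (a \<otimes> b) c * \<nu> i a b \<noteq> 0"
    using i a b c by (simp add: \<nu>_nonzero)
  \<comment> \<open>The braiding scalar is invertible because the left-hand side of the equation containing it
      is a product of units.\<close>
  have "?s \<noteq> 0"
  proof
    assume "?s = 0"
    then show False
      using 1 nz by (simp only: mult_zero_left)
  qed
  then have "\<nu> (i \<otimes> a) b c / \<nu> (i \<otimes> a) c b = (?s * \<nu> (i \<otimes> a) b c) / (?s * \<nu> (i \<otimes> a) c b)"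
    by (rule mult_divide_mult_cancel_left[symmetric])
  also have "\<dots> = (\<nu> a b c * \<nu> i (a \<otimes> b) c * \<nu> i a b) / (\<nu> a c b * \<nu> i (a \<otimes> c) b * \<nu> i a c)"
    by (simp only: 1 2)
  finally show ?thesis
    by simp
qed

end

theorem theorem30:
  fixes C :: "('o, 'm::ab_group_add, 'k::{alg_closed_field, field_char_0}) ribbon_data"
    and A :: "'a monoid"
    and D :: "'a \<Rightarrow> 'o set"
    and lam :: "'a \<Rightarrow> 'a \<Rightarrow> 'o"
    and \<nu> :: "'a \<Rightarrow> 'a \<Rightarrow> 'a \<Rightarrow> 'k"
    and t :: "'a \<Rightarrow> 'a \<Rightarrow> 'k"
    and \<epsilon> :: "'a \<Rightarrow> 'k"
  assumes "strict_ribbon_fusion_category C"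
    and "comm_group A" and "finite (carrier A)"
    and "universal_grading C A D"
    and "ribbon_zesting C A D lam \<nu> t \<epsilon>"
  shows "shadow_rack_2_cocycle A (\<lambda>i a b. inverse (\<nu> i b a) * t a b * \<nu> i a b)"
proof -
  interpret A: comm_group A by fact
  interpret ribbon_zesting C A D lam \<nu> t \<epsilon> by fact
  define \<phi> where "\<phi> i a b = inverse (\<nu> i b a) * t a b * \<nu> i a b" for i a b
  define r where "r i a b = \<nu> i a b / \<nu> i b a" for i a b
  have \<phi>_quot: "\<phi> i a b / \<phi> j a b = r i a b / r j a b"
    if "a \<in> carrier A" "b \<in> carrier A" for i j a b
    using t_nonzero[OF that] by (simp add: \<phi>_def r_def field_simps)
  have "\<phi> i a b / \<phi> (i \<otimes>\<^bsub>A\<^esub> x) a b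
      * inverse (\<phi> i x b / \<phi> (i \<otimes>\<^bsub>A\<^esub> a) x b)
      * (\<phi> i x a / \<phi> (i \<otimes>\<^bsub>A\<^esub> b) x a) = 1"
    if i: "i \<in> carrier A" and x: "x \<in> carrier A" and a: "a \<in> carrier A" and b: "b \<in> carrier A"
    for i x a b
  proof -
    have nz: "\<nu> u v w \<noteq> 0" if "u \<in> carrier A" "v \<in> carrier A" "w \<in> carrier A" for u v w
      using that by (rule \<nu>_nonzero)
    note tr = skew_translate[OF \<open>comm_group A\<close> i, folded r_def]
    have "r i a b / r (i \<otimes>\<^bsub>A\<^esub> x) a b * inverse (r i x b / r (i \<otimes>\<^bsub>A\<^esub> a) x b)
        * (r i x a / r (i \<otimes>\<^bsub>A\<^esub> b) x a)
      = (\<nu> x b a * \<nu> a x b * \<nu> b a x) / (\<nu> x a b * \<nu> a b x * \<nu> b x a)"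
      unfolding tr[OF x a b] tr[OF a x b] tr[OF b x a]
      using i x a b
      by (simp add: r_def nz A.m_comm[of a x] A.m_comm[of b x] A.m_comm[of b a] divide_simps)
    also have "\<dots> = 1"
      using alternating_product_trivial[OF \<open>comm_group A\<close> x a b] x a b by (simp add: nz)
    finally show ?thesis
      using x a b by (simp add: \<phi>_quot)
  qed
  moreover have "\<phi> i a b \<noteq> 0" if "i \<in> carrier A" "a \<in> carrier A" "b \<in> carrier A" for i a b
    using that by (simp add: \<phi>_def \<nu>_nonzero t_nonzero)
  ultimately have "shadow_rack_2_cocycle A \<phi>"
    unfolding shadow_rack_2_cocycle_def by blast
  then show ?thesis
    unfolding \<phi>_def .
qed

end
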